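(* Let $S\ge 1$ be an integer. The function $(p,q)\mapsto D_{KL}(p\|q)$, with $p\in\Delta^S$ and $q\in\mathrm{ri}(\Delta^S)$, is exponential cone representable; that is, its epigraph $$\{(p,q,\epsilon)\in\Delta^S\times\mathrm{ri}(\Delta^S)\times\mathbb{R}:\ D_{KL}(p\|q)\le\epsilon\}$$ is an exponential cone representable set.
   Context: $\mathrm{ri}$ and $\mathrm{cl}$ denote relative interior and closure. The probability simplex is $\Delta^S=\{p\in\mathbb{R}^S_+:\sum_{s=1}^S p_s=1\}$. For $p\in\Delta^S$ and $q\in\mathrm{ri}(\Delta^S)$, the Kullback-Leibler divergence is $D_{KL}(p\|q)=\sum_{s=1}^S p_s\log(p_s/q_s)$, with $0\log0=0$. The exponential cone is $K_{\exp}=\mathrm{cl}\{x\in\mathbb{R}^3: x_1\ge x_2e^{x_3/x_2},\ x_2>0\}$. A cone is regular if it is closed, convex, pointed and full-dimensional; for a regular cone $K$, $x\succeq_K y$ means $x-y\in K$. A set $X\subseteq\mathbb{R}^N$ is conic representable (with respect to $K$) if $X=\{x\in\mathbb{R}^N:\exists z\in\mathbb{R}^k:\ Ax+Bz\succeq_K b\}$ for some matrices $A,B$ and vector $b$. It is exponential cone representable if this holds with $K$ a finite direct product of exponential cones $K_{\exp}$ and nonnegative half-lines $\mathbb{R}_+$ (the latter encoding linear equalities and inequalities). A function is conic (exponential cone) representable if its epigraph is a conic (exponential cone) representable set. *)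

theory Defs
  imports "HOL-Analysis.Analysis" "Jordan_Normal_Form.Matrix"
begin

(* HOL-Analysis and Jordan_Normal_Form both use "$" and "vec": here "$" indexes real ^ 'n,
   while Matrix.vec m f is the m-dimensional vector with entries f 0, ..., f (m - 1). *)
no_notation Matrix.vec_index (infixl "$" 100)
hide_const (open) Finite_Cartesian_Product.vec

definition prob_simplex :: "(real ^ 's::finite) set" where
  "prob_simplex = {p. (\<forall>s. 0 \<le> p $ s) \<and> (\<Sum>s\<in>UNIV. p $ s) = 1}"

(* The convention 0 log 0 = 0 holds automatically, the summand being 0 * ln (0 / q s) = 0. *)
definition kl_div :: "real ^ 's::finite \<Rightarrow> real ^ 's \<Rightarrow> real" where
  "kl_div p q = (\<Sum>s\<in>UNIV. p $ s * ln (p $ s / q $ s))"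

definition exp_cone :: "(real ^ 3) set" where
  "exp_cone = closure {x. x $ 1 \<ge> x $ 2 * exp (x $ 3 / x $ 2) \<and> x $ 2 > 0}"

(* The dimension of the cone K and the number k of auxiliary variables are existentially
   quantified below, so cones and auxiliary vectors live in carrier_vec, not in real ^ 'n. *)

definition exp_cone_vec :: "real vec set" where
  "exp_cone_vec = {vec_of_list [x $ 1, x $ 2, x $ 3] |x. x \<in> exp_cone}"

definition half_line_vec :: "real vec set" where
  "half_line_vec = {vec_of_list [t] |t. 0 \<le> t}"

definition direct_product :: "real vec set \<Rightarrow> real vec set \<Rightarrow> real vec set" where
  "direct_product K L = {u @\<^sub>v v |u v. u \<in> K \<and> v \<in> L}"

(* exp_cone_product m K: K is a finite direct product, in any order, of exponential cones and
   nonnegative half-lines, of total dimension m. *)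
inductive exp_cone_product :: "nat \<Rightarrow> real vec set \<Rightarrow> bool" where
  empty: "exp_cone_product 0 {0\<^sub>v 0}"
| exp_cone: "exp_cone_product m K \<Longrightarrow> exp_cone_product (3 + m) (direct_product exp_cone_vec K)"
| half_line: "exp_cone_product m K \<Longrightarrow> exp_cone_product (1 + m) (direct_product half_line_vec K)"

definition cone_ge :: "real vec set \<Rightarrow> real vec \<Rightarrow> real vec \<Rightarrow> bool" where
  "cone_ge K x y \<longleftrightarrow> x - y \<in> K"

(* K is a cone in carrier_vec m.  The ambient space of X is an arbitrary Euclidean space 'a, so
   the matrix A is given by its rows A 0, ..., A (m - 1) in 'a. *)
definition conic_representable :: "nat \<Rightarrow> real vec set \<Rightarrow> 'a::euclidean_space set \<Rightarrow> bool" where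
  "conic_representable m K X \<longleftrightarrow>
    (\<exists>k (A :: nat \<Rightarrow> 'a) B b. B \<in> carrier_mat m k \<and> b \<in> carrier_vec m \<and>
      X = {x. \<exists>z\<in>carrier_vec k. cone_ge K (Matrix.vec m (\<lambda>i. inner (A i) x) + B *\<^sub>v z) b})"

definition exp_cone_representable :: "'a::euclidean_space set \<Rightarrow> bool" where
  "exp_cone_representable X \<longleftrightarrow> (\<exists>m K. exp_cone_product m K \<and> conic_representable m K X)"

definition exp_cone_representable_fun ::
    "'a::euclidean_space set \<Rightarrow> ('a \<Rightarrow> real) \<Rightarrow> bool" where
  "exp_cone_representable_fun D f \<longleftrightarrow> exp_cone_representable (epigraph D f)"

end

theory Submission imports Defs begin

text \<open>For \<open>q > 0\<close> the inequality \<open>p ln (p / q) \<le> t\<close> says that \<open>(q, p, -t)\<close> lies in the exponential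
  cone; the case \<open>p = 0\<close> is covered by the boundary points that the closure adds. The divergence is
  bounded by \<open>\<epsilon>\<close> iff such bounds \<open>t\<close> for its summands exist with sum at most \<open>\<epsilon>\<close>. The strict inequality
  \<open>q > 0\<close> is not closed, but it is the projection of the cone constraint \<open>q \<ge> exp z\<close>.\<close>

section \<open>Affine preimages of product cones and their projections\<close>

no_notation scalar_prod (infix "\<bullet>" 70)

text \<open>Representability without auxiliary variables. Such sets are intersected by stacking
  rows, with no bookkeeping for the matrix \<open>B\<close>; the auxiliary variables are ordinary
  coordinates until a single projection at the end.\<close>

definition exp_cone_preimage :: "'a::euclidean_space set \<Rightarrow> bool" where
  "exp_cone_preimage X \<longleftrightarrow> (\<exists>m K (A :: nat \<Rightarrow> 'a) b. exp_cone_product m K \<and>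
      X = {x. Matrix.vec m (\<lambda>i. A i \<bullet> x + b i) \<in> K})"

lemma exp_cone_preimage_UNIV: "exp_cone_preimage UNIV"
proof -
  have "Matrix.vec 0 f = 0\<^sub>v 0" for f :: "nat \<Rightarrow> real" by auto
  then show ?thesis
    unfolding exp_cone_preimage_def using exp_cone_product.empty by fastforce
qed

text \<open>All vectors in \<open>K\<close> have the length of \<open>u\<close>, so a concatenation
  can be split in only one way.\<close>

lemma append_vec_mem_direct_product:
  assumes "K \<subseteq> carrier_vec n" "u \<in> carrier_vec n"
  shows "u @\<^sub>v v \<in> direct_product K L \<longleftrightarrow> u \<in> K \<and> v \<in> L"
proof
  assume "u @\<^sub>v v \<in> direct_product K L"
  then obtain u' v' where *: "u @\<^sub>v v = u' @\<^sub>v v'" "u' \<in> K" "v' \<in> L"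
    unfolding direct_product_def by blast
  have "u = u' \<and> v = v'"
    using append_vec_eq[of u n u' v v'] assms * by blast
  with * show "u \<in> K \<and> v \<in> L" by simp
qed (auto simp: direct_product_def)

lemma vec_add_eq_append:
  "Matrix.vec (n + m) f = Matrix.vec n f @\<^sub>v Matrix.vec m (\<lambda>i. f (n + i))"
  by (rule eq_vecI) auto

text \<open>Riesz representation: constraints can be stated with linear functionals, although a cone
  preimage requires its rows as vectors.\<close>

lemma linear_functional_eq_inner:
  fixes f :: "'a::euclidean_space \<Rightarrow> real"
  assumes "linear f"
  shows "\<exists>a. \<forall>x. f x = a \<bullet> x"
proof (intro exI allI)
  show "f x = adjoint f 1 \<bullet> x" for x
    using adjoint_works[OF assms, of x 1] by (simp add: inner_commute)
qed

text \<open>Stacking the two systems of rows turns the intersection into membership in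
  \<open>direct_product K L\<close>. The second hypothesis abstracts over the two constructors of
  \<open>exp_cone_product\<close>, so one argument serves both base cones.\<close>

lemma exp_cone_preimage_Int_product:
  fixes X :: "'a::euclidean_space set" and a :: "nat \<Rightarrow> 'a"
  assumes X: "exp_cone_preimage X"
    and K: "\<And>m L. exp_cone_product m L \<Longrightarrow> exp_cone_product (n + m) (direct_product K L)"
    and dim: "K \<subseteq> carrier_vec n"
  shows "exp_cone_preimage (X \<inter> {x. Matrix.vec n (\<lambda>i. a i \<bullet> x + c i) \<in> K})"
proof -
  from X obtain m L A b where L: "exp_cone_product m L"
    and X_eq: "X = {x. Matrix.vec m (\<lambda>i. A i \<bullet> x + b i) \<in> L}"
    unfolding exp_cone_preimage_def by blast
  \<comment> \<open>The new rows come first because \<open>exp_cone_product\<close> adds factors at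
    the front.\<close>
  define A' where "A' = (\<lambda>i. if i < n then a i else A (i - n))"
  define b' where "b' = (\<lambda>i. if i < n then c i else b (i - n))"
  have "Matrix.vec (n + m) (\<lambda>i. A' i \<bullet> x + b' i) =
      Matrix.vec n (\<lambda>i. a i \<bullet> x + c i) @\<^sub>v Matrix.vec m (\<lambda>i. A i \<bullet> x + b i)" for x
    unfolding vec_add_eq_append by (auto simp: A'_def b'_def intro!: arg_cong2[where f = append_vec])
  then have "X \<inter> {x. Matrix.vec n (\<lambda>i. a i \<bullet> x + c i) \<in> K} =
      {x. Matrix.vec (n + m) (\<lambda>i. A' i \<bullet> x + b' i) \<in> direct_product K L}"
    by (auto simp: X_eq append_vec_mem_direct_product[OF dim])
  then show ?thesis
    unfolding exp_cone_preimage_def using K[OF L] by blast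
qed

lemma vec_1_mem_half_line_vec: "Matrix.vec 1 f \<in> half_line_vec \<longleftrightarrow> 0 \<le> f 0"
proof -
  have "Matrix.vec 1 f = vec_of_list [t] \<longleftrightarrow> f 0 = t" for t
    by (auto simp: vec_eq_iff)
  then show ?thesis unfolding half_line_vec_def by auto
qed

lemma vec_3_mem_exp_cone_vec:
  "Matrix.vec 3 f \<in> exp_cone_vec \<longleftrightarrow> vector [f 0, f 1, f 2] \<in> exp_cone"
proof -
  have "Matrix.vec 3 f = vec_of_list [x $ 1, x $ 2, x $ 3] \<longleftrightarrow> x = vector [f 0, f 1, f 2]"
    for x :: "real ^ 3"
    by (auto simp: Matrix.vec_eq_iff Finite_Cartesian_Product.vec_eq_iff forall_3 vector_3
        numeral_3_eq_3 less_Suc_eq numeral_2_eq_2)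
  then show ?thesis unfolding exp_cone_vec_def by (simp only: mem_Collect_eq simp_thms)
qed

lemma exp_cone_preimage_Int_le:
  fixes f :: "'a::euclidean_space \<Rightarrow> real"
  assumes "exp_cone_preimage X" "linear f"
  shows "exp_cone_preimage (X \<inter> {x. c \<le> f x})"
proof -
  obtain a where a: "\<And>x. f x = a \<bullet> x" using linear_functional_eq_inner[OF assms(2)] by blast
  have "exp_cone_preimage (X \<inter> {x. Matrix.vec 1 (\<lambda>i. a \<bullet> x + (- c)) \<in> half_line_vec})"
    by (rule exp_cone_preimage_Int_product[OF assms(1)])
      (fact exp_cone_product.half_line, auto intro: carrier_vecI simp: half_line_vec_def)
  then show ?thesis by (simp add: vec_1_mem_half_line_vec[unfolded One_nat_def] a)
qed

lemma exp_cone_preimage_Int_eq: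
  fixes f :: "'a::euclidean_space \<Rightarrow> real"
  assumes "exp_cone_preimage X" "linear f"
  shows "exp_cone_preimage (X \<inter> {x. f x = c})"
proof -
  have "exp_cone_preimage (X \<inter> {x. c \<le> f x} \<inter> {x. - c \<le> - f x})"
    using assms by (intro exp_cone_preimage_Int_le linear_compose_neg)
  moreover have "X \<inter> {x. c \<le> f x} \<inter> {x. - c \<le> - f x} = X \<inter> {x. f x = c}" by auto
  ultimately show ?thesis by simp
qed

text \<open>A constant in the second coordinate alone suffices for both later uses: the entropy
  constraints take \<open>c = 0\<close>, the positivity constraints take \<open>g = 0\<close> and
  \<open>c = 1\<close>.\<close>

lemma exp_cone_preimage_Int_exp_cone:
  fixes f g h :: "'a::euclidean_space \<Rightarrow> real"
  assumes "exp_cone_preimage X" "linear f" "linear g" "linear h"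
  shows "exp_cone_preimage (X \<inter> {x. vector [f x, g x + c, h x] \<in> exp_cone})"
proof -
  obtain u v w where *: "\<And>x. f x = u \<bullet> x" "\<And>x. g x = v \<bullet> x" "\<And>x. h x = w \<bullet> x"
    using assms(2-4) by (metis linear_functional_eq_inner)
  have "exp_cone_preimage
      (X \<inter> {x. Matrix.vec 3 (\<lambda>i. ([u, v, w] ! i) \<bullet> x + [0, c, 0] ! i) \<in> exp_cone_vec})"
    by (rule exp_cone_preimage_Int_product[OF assms(1)])
      (fact exp_cone_product.exp_cone, auto intro: carrier_vecI simp: exp_cone_vec_def)
  then show ?thesis by (simp add: vec_3_mem_exp_cone_vec *)
qed

lemma exp_cone_preimage_Int_exp_cone_family:
  fixes f g h :: "'i \<Rightarrow> 'a::euclidean_space \<Rightarrow> real"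
  assumes "finite I" "exp_cone_preimage X"
    and "\<And>i. linear (f i)" "\<And>i. linear (g i)" "\<And>i. linear (h i)"
  shows "exp_cone_preimage (X \<inter> {x. \<forall>i\<in>I. vector [f i x, g i x + c, h i x] \<in> exp_cone})"
  using assms(1)
proof induction
  case (insert i I)
  have "exp_cone_preimage (X \<inter> {x. \<forall>i\<in>I. vector [f i x, g i x + c, h i x] \<in> exp_cone} \<inter>
      {x. vector [f i x, g i x + c, h i x] \<in> exp_cone})"
    by (intro exp_cone_preimage_Int_exp_cone insert.IH assms)
  moreover have "X \<inter> {x. \<forall>i\<in>I. vector [f i x, g i x + c, h i x] \<in> exp_cone} \<inter>
      {x. vector [f i x, g i x + c, h i x] \<in> exp_cone} =
      X \<inter> {x. \<forall>i\<in>insert i I. vector [f i x, g i x + c, h i x] \<in> exp_cone}" by blast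
  ultimately show ?case by simp
qed (simp add: assms)

text \<open>The coordinates of \<open>y\<close> in an orthonormal basis serve as the auxiliary
  vector \<open>z\<close>. Each row \<open>A i\<close> splits into its two components, the second
  one giving row \<open>i\<close> of \<open>B\<close>, and the offset \<open>b\<close> moves to the
  right-hand side as \<open>- b\<close>.\<close>

lemma exp_cone_representable_projection:
  fixes Y :: "('a::euclidean_space \<times> 'b::euclidean_space) set"
  assumes "exp_cone_preimage Y"
  shows "exp_cone_representable {x. \<exists>y. (x, y) \<in> Y}"
proof -
  from assms obtain m K A b where K: "exp_cone_product m K"
    and Y: "Y = {x. Matrix.vec m (\<lambda>i. A i \<bullet> x + b i) \<in> K}"
    unfolding exp_cone_preimage_def by blast
  define k where "k = DIM('b)"
  obtain e :: "nat \<Rightarrow> 'b" where e: "bij_betw e {0..<k} Basis"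
    unfolding k_def using ex_bij_betw_nat_finite[OF finite_Basis] by blast
  define B where "B = Matrix.mat m k (\<lambda>(i, j). snd (A i) \<bullet> e j)"
  define comb where "comb z = (\<Sum>j<k. vec_index z j *\<^sub>R e j)" for z
  have row: "Matrix.vec m (\<lambda>i. fst (A i) \<bullet> x) + B *\<^sub>v z - Matrix.vec m (\<lambda>i. - b i) =
      Matrix.vec m (\<lambda>i. A i \<bullet> (x, comb z) + b i)" if "z \<in> carrier_vec k" for x z
    using that by (intro eq_vecI)
      (auto simp: B_def comb_def scalar_prod_def inner_prod_def inner_sum_right atLeast0LessThan
        mult.commute)
  \<comment> \<open>Every \<open>y\<close> is the combination of the basis with its own coordinates,
    so quantifying over \<open>z\<close> loses nothing.\<close>
  have surj: "\<exists>z\<in>carrier_vec k. y = comb z" for y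
  proof
    have "comb (Matrix.vec k (\<lambda>j. y \<bullet> e j)) = (\<Sum>j\<in>{0..<k}. (y \<bullet> e j) *\<^sub>R e j)"
      by (simp add: comb_def atLeast0LessThan)
    also have "\<dots> = y"
      using sum.reindex_bij_betw[OF e, of "\<lambda>u. (y \<bullet> u) *\<^sub>R u"] by (simp add: euclidean_representation)
    finally show "y = comb (Matrix.vec k (\<lambda>j. y \<bullet> e j))" ..
  qed simp
  have "{x. \<exists>y. (x, y) \<in> Y} = {x. \<exists>z\<in>carrier_vec k.
      cone_ge K (Matrix.vec m (\<lambda>i. fst (A i) \<bullet> x) + B *\<^sub>v z) (Matrix.vec m (\<lambda>i. - b i))}"
    unfolding cone_ge_def Y mem_Collect_eq using surj by (auto simp: row) metis
  moreover have "B \<in> carrier_mat m k" by (simp add: B_def)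
  ultimately have "conic_representable m K {x. \<exists>y. (x, y) \<in> Y}"
    unfolding conic_representable_def
    by (intro exI[of _ k] exI[of _ "\<lambda>i. fst (A i)"] exI[of _ B] exI[of _ "Matrix.vec m (\<lambda>i. - b i)"]) simp
  then show ?thesis unfolding exp_cone_representable_def using K by blast
qed

section \<open>Membership in the exponential cone\<close>

text \<open>The tangents of \<open>exp\<close> at all points \<open>a\<close> turn the defining inequality into a family of linear
  ones, and these survive the closure.\<close>

lemma exp_cone_tangent:
  assumes "x \<in> exp_cone"
  shows "0 \<le> x $ 2" "exp a * (x $ 3 + (1 - a) * x $ 2) \<le> x $ 1"
proof -
  define C where "C = {x :: real ^ 3. 0 \<le> x $ 2 \<and> exp a * (x $ 3 + (1 - a) * x $ 2) \<le> x $ 1}"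
  have "closed C"
    unfolding C_def by (intro closed_Collect_conj closed_Collect_le continuous_intros)
  moreover have "x \<in> C" if "x $ 2 * exp (x $ 3 / x $ 2) \<le> x $ 1" "0 < x $ 2" for x
  proof -
    have "exp a * (x $ 3 + (1 - a) * x $ 2) = x $ 2 * (exp a * (1 + (x $ 3 / x $ 2 - a)))"
      using that(2) by (simp add: field_simps)
    also have "\<dots> \<le> x $ 2 * (exp a * exp (x $ 3 / x $ 2 - a))"
      using that(2) by (intro mult_left_mono exp_ge_add_one_self) auto
    also have "\<dots> = x $ 2 * exp (x $ 3 / x $ 2)"
      by (simp flip: exp_add)
    finally show ?thesis using that by (simp add: C_def)
  qed
  ultimately have "exp_cone \<subseteq> C"
    unfolding exp_cone_def by (intro closure_minimal) auto
  with assms show "0 \<le> x $ 2" "exp a * (x $ 3 + (1 - a) * x $ 2) \<le> x $ 1"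
    by (auto simp: C_def)
qed

lemma exp_cone_iff_pos:
  assumes "0 < y"
  shows "vector [x, y, z] \<in> exp_cone \<longleftrightarrow> y * exp (z / y) \<le> x"
proof
  assume "vector [x, y, z] \<in> exp_cone"
  \<comment> \<open>The tangent at \<open>a = z / y\<close> is the tight one: its left-hand side
    collapses to \<open>y * exp (z / y)\<close>.\<close>
  from exp_cone_tangent(2)[OF this, of "z / y"] assms show "y * exp (z / y) \<le> x"
    by (simp add: vector_3 field_simps)
next
  assume "y * exp (z / y) \<le> x"
  then show "vector [x, y, z] \<in> exp_cone"
    unfolding exp_cone_def using assms by (intro subsetD[OF closure_subset]) (simp add: vector_3)
qed

text \<open>This is the face added by the closure. The tangent inequalities become
  \<open>exp a * z \<le> x\<close> for all \<open>a\<close>: large \<open>a\<close> forces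
  \<open>z \<le> 0\<close>, and \<open>a\<close> tending to minus infinity forces
  \<open>0 \<le> x\<close>. Conversely, such points are limits of cone points with positive second
  coordinate.\<close>

lemma exp_cone_iff_zero:
  "vector [x, 0, z] \<in> exp_cone \<longleftrightarrow> 0 \<le> x \<and> z \<le> 0"
proof
  assume "vector [x, 0, z] \<in> exp_cone"
  from exp_cone_tangent(2)[OF this] have le: "exp a * z \<le> x" for a
    by (simp add: vector_3)
  have z: "z \<le> 0"
  proof (rule ccontr)
    assume "\<not> z \<le> 0"
    \<comment> \<open>The tangent point \<open>\<bar>x\<bar> / z\<close> is chosen so that
      \<open>1 + a \<le> exp a\<close> already pushes the left-hand side above
      \<open>x\<close>.\<close>
    then have "z + \<bar>x\<bar> = (1 + \<bar>x\<bar> / z) * z" by (simp add: field_simps)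
    also have "\<dots> \<le> exp (\<bar>x\<bar> / z) * z"
      using \<open>\<not> z \<le> 0\<close> by (intro mult_right_mono exp_ge_add_one_self) auto
    also have "\<dots> \<le> x" by (rule le)
    finally show False using \<open>\<not> z \<le> 0\<close> by linarith
  qed
  have "((\<lambda>a. exp a * z) \<longlongrightarrow> 0 * z) at_bot"
    by (intro tendsto_intros exp_at_bot)
  then have "0 \<le> x" using le by (intro tendsto_upperbound[of _ 0 at_bot]) auto
  with z show "0 \<le> x \<and> z \<le> 0" by simp
next
  assume *: "0 \<le> x \<and> z \<le> 0"
  \<comment> \<open>Since \<open>z \<le> 0\<close>, the exponential factor is at most 1, so raising
    the first coordinate by the same amount as the second keeps the point in the cone.\<close>
  define X where "X n = (vector [x + inverse (real (Suc n)), inverse (real (Suc n)), z] :: real ^ 3)" for n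
  have "X n \<in> exp_cone" for n
  proof -
    have "inverse (real (Suc n)) * exp (z / inverse (real (Suc n))) \<le> inverse (real (Suc n)) * 1"
      using * by (intro mult_left_mono) (auto simp: mult_nonpos_nonneg divide_nonpos_pos simp del: inverse_eq_divide)
    then have "inverse (real (Suc n)) * exp (z / inverse (real (Suc n))) \<le> x + inverse (real (Suc n))"
      using * by linarith
    then show ?thesis by (simp add: X_def exp_cone_iff_pos del: of_nat_Suc)
  qed
  moreover have "X \<longlonglongrightarrow> vector [x, 0, z]"
  proof (rule vec_tendstoI)
    fix i :: 3
    have "(\<lambda>n. x + inverse (real (Suc n))) \<longlonglongrightarrow> x + 0"
      by (intro tendsto_intros LIMSEQ_inverse_real_of_nat)
    then have "\<forall>i. (\<lambda>n. X n $ i) \<longlonglongrightarrow> vector [x, 0, z] $ i"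
      using LIMSEQ_inverse_real_of_nat by (simp add: forall_3 X_def vector_3)
    then show "(\<lambda>n. X n $ i) \<longlonglongrightarrow> vector [x, 0, z] $ i" ..
  qed
  moreover have "closed exp_cone" by (simp add: exp_cone_def)
  ultimately show "vector [x, 0, z] \<in> exp_cone"
    using closed_sequentially by blast
qed

text \<open>For \<open>p > 0\<close>, divide by \<open>p\<close> and take logarithms. For
  \<open>p = 0\<close>, both sides say \<open>0 \<le> t\<close>; for \<open>p < 0\<close>, both
  fail. The cone thus enforces \<open>0 \<le> p\<close> by itself.\<close>

lemma entropy_le_iff_exp_cone:
  assumes "0 < q"
  shows "vector [q, p, - t] \<in> exp_cone \<longleftrightarrow> 0 \<le> p \<and> p * ln (p / q) \<le> t"
proof (cases "0 < p")
  case True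
  have "p * exp (- t / p) \<le> q \<longleftrightarrow> exp (- t / p) \<le> q / p"
    using True by (simp add: field_simps)
  also have "\<dots> \<longleftrightarrow> - t / p \<le> ln (q / p)"
    using True assms by (simp add: ln_ge_iff)
  also have "\<dots> \<longleftrightarrow> p * ln (p / q) \<le> t"
    using True assms by (simp add: ln_div field_simps)
  finally show ?thesis using True by (simp add: exp_cone_iff_pos)
next
  case False
  then show ?thesis
    using assms exp_cone_tangent(1)[of "vector [q, p, - t]"]
    by (cases "p = 0") (auto simp: exp_cone_iff_zero vector_3)
qed

lemma pos_iff_exp_cone: "(\<exists>z. vector [q, 1, z] \<in> exp_cone) \<longleftrightarrow> 0 < q"
  by (auto simp: exp_cone_iff_pos intro: exI[of _ "ln q"] less_le_trans[OF exp_gt_zero])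

section \<open>Relative interior of the simplex\<close>

text \<open>The simplex is the orthant \<open>P\<close> cut by the affine hyperplane
  \<open>T\<close>. As \<open>T\<close> meets the interior of \<open>P\<close>, the relative
  interior of the intersection is \<open>interior P \<inter> T\<close>.\<close>

lemma rel_interior_prob_simplex:
  "rel_interior (prob_simplex :: (real ^ 's::finite) set) =
    {p. (\<forall>s. 0 < p $ s) \<and> (\<Sum>s\<in>UNIV. p $ s) = 1}"
proof -
  define T where "T = {p :: real ^ 's. (\<Sum>s\<in>UNIV. p $ s) = 1}"
  define P where "P = (\<Inter>s\<in>UNIV. {p :: real ^ 's. 0 \<le> p $ s})"
  have intP: "interior P = {p. \<forall>s. 0 < p $ s}"
  proof
    have "interior P \<subseteq> interior {p. 0 \<le> p $ s}" for s
      by (intro interior_mono) (auto simp: P_def)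
    then show "interior P \<subseteq> {p. \<forall>s. 0 < p $ s}" by auto
    have "open (\<Inter>s\<in>UNIV. {p :: real ^ 's. 0 < p $ s})"
      by (intro open_INT) (auto simp: open_halfspace_component_gt_cart)
    then have "open {p :: real ^ 's. \<forall>s. 0 < p $ s}"
      by (simp add: INTER_eq)
    then show "{p. \<forall>s. 0 < p $ s} \<subseteq> interior P"
      by (intro interior_maximal) (auto simp: P_def less_imp_le)
  qed
  \<comment> \<open>The barycentre witnesses that \<open>T\<close> meets the interior of
    \<open>P\<close>.\<close>
  define u :: "real ^ 's" where "u = (\<chi> s. 1 / CARD('s))"
  have u: "u \<in> interior P" "u \<in> T"
    by (auto simp: intP T_def u_def)
  have "convex P"
    by (auto simp: P_def convex_def)
  moreover have "affine T"
    unfolding affine_def T_def by (auto simp: sum.distrib simp flip: sum_distrib_left)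
  ultimately have "rel_interior (P \<inter> T) = interior P \<inter> T"
    using u by (intro rel_interior_convex_Int_affine) auto
  moreover have "prob_simplex = P \<inter> T"
    by (auto simp: prob_simplex_def P_def T_def)
  ultimately show ?thesis by (auto simp: intP T_def)
qed

section \<open>The epigraph as a projection\<close>

theorem proposition2:
  shows "exp_cone_representable_fun
    ((prob_simplex :: (real ^ 's::finite) set) \<times> rel_interior (prob_simplex :: (real ^ 's) set))
    (\<lambda>(p, q). kl_div p q)"
proof -
  let ?p = "\<lambda>s w. fst (fst (fst w)) $ s"
  let ?q = "\<lambda>s w. snd (fst (fst w)) $ s"
  let ?t = "\<lambda>s w. fst (snd w) $ s"
  let ?z = "\<lambda>s w. snd (snd w) $ s"
  let ?eps = "\<lambda>w. snd (fst w)"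
  \<comment> \<open>A point is \<open>((p, q), eps)\<close> paired with the auxiliary
    \<open>(t, z)\<close>: \<open>t\<close> bounds the summands and \<open>z\<close> certifies
    \<open>q > 0\<close>. The terms \<open>+ 0\<close> and \<open>0 + 1\<close> match the shape
    \<open>g i x + c\<close> of the family lemma.\<close>
  define Y :: "((((real ^ 's) \<times> (real ^ 's)) \<times> real) \<times> (real ^ 's) \<times> (real ^ 's)) set"
    where "Y = UNIV
    \<inter> {w. (\<Sum>s\<in>UNIV. ?p s w) = 1} \<inter> {w. (\<Sum>s\<in>UNIV. ?q s w) = 1}
    \<inter> {w. 0 \<le> ?eps w - (\<Sum>s\<in>UNIV. ?t s w)}
    \<inter> {w. \<forall>s\<in>UNIV. vector [?q s w, ?p s w + 0, - ?t s w] \<in> exp_cone}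
    \<inter> {w. \<forall>s\<in>UNIV. vector [?q s w, 0 + 1, ?z s w] \<in> exp_cone}"
  have "exp_cone_preimage Y"
    unfolding Y_def
    by (intro exp_cone_preimage_Int_exp_cone_family exp_cone_preimage_Int_le
        exp_cone_preimage_Int_eq exp_cone_preimage_UNIV finite_class.finite_UNIV)
      (auto simp: linear_iff sum.distrib right_diff_distrib sum_distrib_left)
  then have "exp_cone_representable {x. \<exists>y. (x, y) \<in> Y}"
    by (rule exp_cone_representable_projection)
  moreover have iff: "((p, q), eps) \<in> {x. \<exists>y. (x, y) \<in> Y} \<longleftrightarrow>
      ((p, q), eps) \<in> epigraph (prob_simplex \<times> rel_interior prob_simplex) (\<lambda>(p, q). kl_div p q)"
    for p q :: "real ^ 's" and eps
  proof
    assume "((p, q), eps) \<in> {x. \<exists>y. (x, y) \<in> Y}"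
    then obtain t z where sums: "(\<Sum>s\<in>UNIV. p $ s) = 1" "(\<Sum>s\<in>UNIV. q $ s) = 1"
      and t: "(\<Sum>s\<in>UNIV. t $ s) \<le> eps"
      and cone: "\<And>s. vector [q $ s, p $ s, - t $ s] \<in> exp_cone"
      and "\<And>s. vector [q $ s, 1, z $ s] \<in> exp_cone"
      by (auto simp: Y_def)
    \<comment> \<open>Positivity of \<open>q\<close> comes first, because reading the other cone
      constraints as entropy bounds depends on it.\<close>
    then have q: "0 < q $ s" for s using pos_iff_exp_cone by blast
    from cone have "0 \<le> p $ s" "p $ s * ln (p $ s / q $ s) \<le> t $ s" for s
      using entropy_le_iff_exp_cone[OF q] by auto
    with t have "kl_div p q \<le> eps" "\<forall>s. 0 \<le> p $ s"
      unfolding kl_div_def by (auto intro: order_trans[OF sum_mono])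
    with sums q show "((p, q), eps) \<in> epigraph (prob_simplex \<times> rel_interior prob_simplex) (\<lambda>(p, q). kl_div p q)"
      by (simp add: epigraph_def rel_interior_prob_simplex) (simp add: prob_simplex_def)
  next
    assume *: "((p, q), eps) \<in> epigraph (prob_simplex \<times> rel_interior prob_simplex) (\<lambda>(p, q). kl_div p q)"
    then have p: "\<And>s. 0 \<le> p $ s" and q: "\<And>s. 0 < q $ s"
      and sums: "(\<Sum>s\<in>UNIV. p $ s) = 1" "(\<Sum>s\<in>UNIV. q $ s) = 1" and le: "kl_div p q \<le> eps"
      by (auto simp: epigraph_def rel_interior_prob_simplex) (auto simp: prob_simplex_def)
    \<comment> \<open>The smallest admissible bounds: their sum is exactly
      \<open>kl_div p q\<close>.\<close>
    define t where "t = (\<chi> s. p $ s * ln (p $ s / q $ s))"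
    from q have "\<forall>s. \<exists>z. vector [q $ s, 1, z] \<in> exp_cone"
      by (simp add: pos_iff_exp_cone)
    then obtain z where "\<And>s. vector [q $ s, 1, z s] \<in> exp_cone"
      by metis
    moreover have "vector [q $ s, p $ s, - t $ s] \<in> exp_cone" for s
      using entropy_le_iff_exp_cone[OF q] p by (simp add: t_def)
    ultimately have "(((p, q), eps), (t, \<chi> s. z s)) \<in> Y"
      using sums le by (simp add: Y_def kl_div_def t_def)
    then show "((p, q), eps) \<in> {x. \<exists>y. (x, y) \<in> Y}" by blast
  qed
  have "{x. \<exists>y. (x, y) \<in> Y} =
      epigraph (prob_simplex \<times> rel_interior prob_simplex) (\<lambda>(p, q). kl_div p q)"
  proof (rule Set.set_eqI)
    fix x :: "((real ^ 's) \<times> (real ^ 's)) \<times> real"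
    obtain p q eps where "x = ((p, q), eps)" by (metis prod.exhaust)
    then show "x \<in> {x. \<exists>y. (x, y) \<in> Y} \<longleftrightarrow>
        x \<in> epigraph (prob_simplex \<times> rel_interior prob_simplex) (\<lambda>(p, q). kl_div p q)"
      using iff by blast
  qed
  ultimately show ?thesis by (simp add: exp_cone_representable_fun_def)
qed

end
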